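(* Let $H$ be a separable Hilbert space. Let $K$ be a compact subset of $[0,1]$ such that $0\in K$. Then there exist two orthogonal projections $P_1,P_2$ on $H$ such that $\sigma(P_2P_1)=K$. Moreover, $P_1P_2P_1$ is diagonalizable.
   Context: $\sigma(T)$ denotes the spectrum of a bounded operator $T$ on $H$. The operator $P_1P_2P_1$ is called diagonalizable if there exist an orthonormal basis $(\tilde h_n)_{n\in\mathbb{N}}$ of $H$ and a sequence of scalars $(\tilde\lambda_n)_{n\in\mathbb{N}}$ such that $P_1P_2P_1x=\sum_{n\in\mathbb{N}}\tilde\lambda_n\langle x,\tilde h_n\rangle\tilde h_n$ for all $x\in H$.
   Formalization: H is taken to be an infinite-dimensional complex Hilbert space: in finite dimension the claim fails (a spectrum is finite, so K=[0,1] is impossible, and no orthonormal basis indexed by the natural numbers exists). *)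

theory Defs
  imports "HOL-Analysis.Analysis"
begin

class complex_vector = real_vector +
  fixes scaleC :: "complex \<Rightarrow> 'a \<Rightarrow> 'a" (infixr "*\<^sub>C" 75)
  assumes scaleC_add_right: "a *\<^sub>C (x + y) = a *\<^sub>C x + a *\<^sub>C y"
    and scaleC_add_left: "(a + b) *\<^sub>C x = a *\<^sub>C x + b *\<^sub>C x"
    and scaleC_scaleC: "a *\<^sub>C (b *\<^sub>C x) = (a * b) *\<^sub>C x"
    and scaleC_one: "1 *\<^sub>C x = x"
    and scaleR_scaleC: "r *\<^sub>R x = complex_of_real r *\<^sub>C x"

global_interpretation complex_vector: vector_space "scaleC :: complex \<Rightarrow> 'a \<Rightarrow> 'a::complex_vector"
  defines csubspace = complex_vector.subspace
    and cspan = complex_vector.span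
  by unfold_locales (simp_all add: scaleC_add_right scaleC_add_left scaleC_scaleC scaleC_one)

text \<open>The inner product is linear in its first and conjugate linear in its second argument.
  Positive definiteness is contained in \<open>cinner_self\<close>, the norm being that of a
  real normed space.\<close>

class complex_inner = complex_vector + real_normed_vector +
  fixes cinner :: "'a \<Rightarrow> 'a \<Rightarrow> complex"
  assumes cinner_commute: "cinner x y = cnj (cinner y x)"
    and cinner_add_left: "cinner (x + y) z = cinner x z + cinner y z"
    and cinner_scaleC_left: "cinner (c *\<^sub>C x) y = c * cinner x y"
    and cinner_self: "cinner x x = complex_of_real ((norm x)\<^sup>2)"

class chilbert_space = complex_inner + complete_space

definition bounded_clinear :: "('a::complex_inner \<Rightarrow> 'b::complex_inner) \<Rightarrow> bool"
  where "bounded_clinear T \<longleftrightarrow> bounded_linear T \<and> (\<forall>c x. T (c *\<^sub>C x) = c *\<^sub>C T x)"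

definition op_spectrum :: "('a::chilbert_space \<Rightarrow> 'a) \<Rightarrow> complex set"
  where "op_spectrum T = {z. \<not> (\<exists>S. bounded_clinear S \<and>
    (\<forall>x. S (T x - z *\<^sub>C x) = x) \<and> (\<forall>x. T (S x) - z *\<^sub>C S x = x))}"

definition orthogonal_projection_onto :: "('a::chilbert_space \<Rightarrow> 'a) \<Rightarrow> 'a set \<Rightarrow> bool"
  where "orthogonal_projection_onto P M \<longleftrightarrow> (\<forall>x. P x \<in> M \<and> (\<forall>y\<in>M. cinner (x - P x) y = 0))"

definition orthogonal_projection :: "('a::chilbert_space \<Rightarrow> 'a) \<Rightarrow> bool"
  where "orthogonal_projection P \<longleftrightarrow>
    (\<exists>M. csubspace M \<and> closed M \<and> orthogonal_projection_onto P M)"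

definition orthonormal_basis :: "(nat \<Rightarrow> 'a::chilbert_space) \<Rightarrow> bool"
  where "orthonormal_basis h \<longleftrightarrow>
    (\<forall>m n. cinner (h m) (h n) = (if m = n then 1 else 0)) \<and> closure (cspan (range h)) = UNIV"

definition diagonalizable :: "('a::chilbert_space \<Rightarrow> 'a) \<Rightarrow> bool"
  where "diagonalizable T \<longleftrightarrow>
    (\<exists>h l. orthonormal_basis h \<and> (\<forall>x. (\<lambda>n. (l n * cinner x (h n)) *\<^sub>C h n) sums T x))"

definition infinite_dimensional :: "'a::complex_vector itself \<Rightarrow> bool"
  where "infinite_dimensional _ \<longleftrightarrow> \<not> (\<exists>B :: 'a set. finite B \<and> cspan B = UNIV)"

end

theory Submission
  imports Defs
begin

text \<open>
  Two lines in a plane that enclose the angle \<open>\<theta>\<close> have projections \<open>p\<^sub>1, p\<^sub>2\<close> for which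
  \<open>p\<^sub>2 p\<^sub>1\<close> has the eigenvalues \<open>0\<close> and \<open>t = cos\<^sup>2 \<theta>\<close>, the latter on the second line, while
  \<open>p\<^sub>1 p\<^sub>2 p\<^sub>1\<close> is \<open>t p\<^sub>1\<close>. Every \<open>t \<in> [0,1]\<close> occurs. So split an orthonormal basis of the space into
  pairs \<open>u\<^sub>n, w\<^sub>n\<close>, take a sequence \<open>t\<^sub>n\<close> that is dense in \<open>K\<close>, and put the lines spanned by \<open>u\<^sub>n\<close>
  and by \<open>v\<^sub>n = \<surd>t\<^sub>n u\<^sub>n + \<surd>(1 - t\<^sub>n) w\<^sub>n\<close> into the \<open>n\<close>-th plane. \<open>P\<^sub>1\<close> and \<open>P\<^sub>2\<close> are the projections onto
  the closed spans of all \<open>u\<^sub>n\<close> and of all \<open>v\<^sub>n\<close>. Then \<open>P\<^sub>1 P\<^sub>2 P\<^sub>1\<close> is diagonal in the basis, with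
  entries \<open>t\<^sub>n\<close> at \<open>u\<^sub>n\<close> and \<open>0\<close> at \<open>w\<^sub>n\<close>.

  The spectrum of \<open>P\<^sub>2 P\<^sub>1\<close> contains \<open>K\<close>, since \<open>P\<^sub>2 P\<^sub>1 v\<^sub>n = t\<^sub>n v\<^sub>n\<close> makes every limit of the \<open>t\<^sub>n\<close> an
  approximate eigenvalue (\<open>approximate_eigenvalue_in_spectrum\<close>). Conversely, \<open>P\<^sub>2 P\<^sub>1\<close> is in
  general not normal and so not diagonal in an orthonormal basis, but products \<open>BA\<close> and \<open>AB\<close> have the same
  spectrum away from \<open>0\<close> (\<open>nonzero_spectrum_commute\<close>). With \<open>A = P\<^sub>1\<close> and \<open>B = P\<^sub>2 P\<^sub>1\<close> these
  products are \<open>P\<^sub>2 P\<^sub>1\<close> and \<open>P\<^sub>1 P\<^sub>2 P\<^sub>1\<close>, and the spectrum of the latter lies in the closure of its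
  diagonal (\<open>spectrum_diagonal_op_subset\<close>), hence in \<open>K\<close>. The point \<open>0\<close> belongs to \<open>K\<close> by
  hypothesis.

  The other operators involved are of the form \<open>x \<mapsto> \<Sum>\<^sub>n l\<^sub>n \<langle>x, f\<^sub>n\<rangle> f\<^sub>n\<close> with \<open>f\<close> orthonormal and \<open>l\<close> bounded:
  the two projections with \<open>l = 1\<close>, and \<open>P\<^sub>1 P\<^sub>2 P\<^sub>1\<close> and its resolvents on the basis. Identities
  between such operators are checked on basis vectors (\<open>bounded_clinear_eqI\<close>).
\<close>

section \<open>Inner product geometry\<close>

lemma cinner_add_right: "cinner x (y + z) = cinner x y + cinner (x::'a::complex_inner) z"
  by (metis cinner_commute cinner_add_left complex_cnj_add)

lemma cinner_scaleC_right: "cinner x (c *\<^sub>C y) = cnj c * cinner (x::'a::complex_inner) y"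
  by (metis cinner_commute cinner_scaleC_left complex_cnj_mult)

lemma cinner_scaleR_left: "cinner (r *\<^sub>R x) y = r *\<^sub>R cinner (x::'a::complex_inner) y"
  by (simp add: scaleR_scaleC cinner_scaleC_left scaleR_conv_of_real)

lemma cinner_scaleR_right: "cinner x (r *\<^sub>R y) = r *\<^sub>R cinner (x::'a::complex_inner) y"
  by (simp add: scaleR_scaleC cinner_scaleC_right scaleR_conv_of_real)

lemma cinner_zero_left [simp]: "cinner 0 (x::'a::complex_inner) = 0"
  using cinner_add_left[of 0 0 x] by simp

lemma cinner_zero_right [simp]: "cinner (x::'a::complex_inner) 0 = 0"
  using cinner_add_right[of x 0 0] by simp

lemma cinner_diff_left: "cinner (x - y) z = cinner x z - cinner (y::'a::complex_inner) z"
  using cinner_add_left[of "x - y" y z] by simp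

lemma cinner_diff_right: "cinner x (y - z) = cinner x y - cinner (x::'a::complex_inner) z"
  using cinner_add_right[of x "y - z" z] by simp

lemma cinner_sum_left: "cinner (\<Sum>i\<in>A. f i) y = (\<Sum>i\<in>A. cinner (f i) (y::'a::complex_inner))"
  by (induction A rule: infinite_finite_induct) (simp_all add: cinner_add_left)

lemma cinner_sum_right: "cinner y (\<Sum>i\<in>A. f i) = (\<Sum>i\<in>A. cinner (y::'a::complex_inner) (f i))"
  by (induction A rule: infinite_finite_induct) (simp_all add: cinner_add_right)

lemma norm_scaleC: "norm (c *\<^sub>C (x::'a::complex_inner)) = norm c * norm x"
proof -
  have "complex_of_real ((norm (c *\<^sub>C x))\<^sup>2) = cinner (c *\<^sub>C x) (c *\<^sub>C x)"
    by (simp only: cinner_self)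
  also have "\<dots> = (c * cnj c) * cinner x x"
    by (simp add: cinner_scaleC_left cinner_scaleC_right)
  also have "\<dots> = complex_of_real ((norm c * norm x)\<^sup>2)"
    by (simp only: cinner_self complex_norm_square[symmetric] of_real_mult power_mult_distrib)
  finally have "(norm (c *\<^sub>C x))\<^sup>2 = (norm c * norm x)\<^sup>2"
    by (simp only: of_real_eq_iff)
  then show ?thesis
    by (simp add: power2_eq_iff_nonneg)
qed

definition orthonormal_family :: "'i set \<Rightarrow> ('i \<Rightarrow> 'a::complex_inner) \<Rightarrow> bool"
  where "orthonormal_family I f \<longleftrightarrow>
    (\<forall>i\<in>I. \<forall>j\<in>I. cinner (f i) (f j) = (if i = j then 1 else 0))"

lemma orthonormal_familyD:
  "orthonormal_family I f \<Longrightarrow> i \<in> I \<Longrightarrow> j \<in> I \<Longrightarrow> cinner (f i) (f j) = (if i = j then 1 else 0)"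
  by (simp add: orthonormal_family_def)

lemma orthonormal_family_norm:
  assumes "orthonormal_family I f" "i \<in> I"
  shows "norm (f i) = 1"
proof -
  have "complex_of_real ((norm (f i))\<^sup>2) = 1"
    using orthonormal_familyD[OF assms assms(2)] by (simp add: cinner_self)
  then have "(norm (f i))\<^sup>2 = 1"
    by (metis of_real_eq_1_iff)
  then show ?thesis
    by (simp add: power2_eq_1_iff) (smt (verit) norm_ge_zero)
qed

lemma cinner_orthonormal_sum:
  assumes "orthonormal_family I f" "finite A" "A \<subseteq> I" "i \<in> I"
  shows "cinner (\<Sum>j\<in>A. c j *\<^sub>C f j) (f i) = (if i \<in> A then c i else 0)"
proof -
  have "cinner (\<Sum>j\<in>A. c j *\<^sub>C f j) (f i) = (\<Sum>j\<in>A. if j = i then c j else 0)"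
    unfolding cinner_sum_left cinner_scaleC_left
    using assms by (intro sum.cong) (auto simp: orthonormal_familyD)
  then show ?thesis
    using assms(2) by simp
qed

lemma norm_orthonormal_sum:
  assumes "orthonormal_family I f" "finite A" "A \<subseteq> I"
  shows "(norm (\<Sum>i\<in>A. c i *\<^sub>C f i))\<^sup>2 = (\<Sum>i\<in>A. (norm (c i))\<^sup>2)"
proof -
  let ?s = "\<Sum>i\<in>A. c i *\<^sub>C f i"
  have "cinner ?s ?s = (\<Sum>i\<in>A. cnj (c i) * cinner ?s (f i))"
    by (subst cinner_sum_right) (simp add: cinner_scaleC_right)
  also have "\<dots> = (\<Sum>i\<in>A. c i * cnj (c i))"
    using assms(3) by (intro sum.cong refl) (subst cinner_orthonormal_sum[OF assms], auto)
  also have "\<dots> = complex_of_real (\<Sum>i\<in>A. (norm (c i))\<^sup>2)"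
    by (simp only: complex_norm_square of_real_sum)
  finally show ?thesis
    unfolding cinner_self by (simp only: of_real_eq_iff)
qed

text \<open>The defect in the inequality is the squared distance from \<open>x\<close> to its projection onto the span
  of the \<open>f i\<close>.\<close>

lemma bessel_inequality:
  assumes "orthonormal_family I f" "finite A" "A \<subseteq> I"
  shows "(\<Sum>i\<in>A. (norm (cinner x (f i)))\<^sup>2) \<le> (norm x)\<^sup>2"
proof -
  let ?s = "\<Sum>i\<in>A. cinner x (f i) *\<^sub>C f i" and ?b = "\<Sum>i\<in>A. (norm (cinner x (f i)))\<^sup>2"
  have ss: "cinner ?s ?s = complex_of_real ?b"
    unfolding cinner_self using norm_orthonormal_sum[OF assms] by simp
  have xs: "cinner x ?s = complex_of_real ?b"
    by (simp only: cinner_sum_right cinner_scaleC_right complex_norm_square of_real_sum mult.commute)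
  have sx: "cinner ?s x = complex_of_real ?b"
    using cinner_commute[of ?s x] xs by simp
  have "complex_of_real ((norm (x - ?s))\<^sup>2) = cinner (x - ?s) (x - ?s)"
    by (simp only: cinner_self)
  also have "\<dots> = complex_of_real ((norm x)\<^sup>2 - ?b)"
    by (simp only: cinner_diff_left cinner_diff_right ss xs sx) (simp add: cinner_self)
  finally have "(norm (x - ?s))\<^sup>2 = (norm x)\<^sup>2 - ?b"
    by (simp only: of_real_eq_iff)
  then show ?thesis
    by (smt (verit) zero_le_power2)
qed

lemma orthonormal_family_singleton:
  "norm (x::'a::complex_inner) = 1 \<Longrightarrow> orthonormal_family {i} (\<lambda>_. x)"
  by (simp add: orthonormal_family_def cinner_self)

text \<open>Bessel's inequality for the single unit vector in the direction of the second argument.\<close>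

lemma cauchy_schwarz: "norm (cinner x y) \<le> norm x * norm (y::'a::complex_inner)"
proof (cases "y = 0")
  case False
  let ?u = "(1 / norm y) *\<^sub>R y"
  have "(norm (cinner x ?u))\<^sup>2 \<le> (norm x)\<^sup>2"
    using bessel_inequality[OF orthonormal_family_singleton[of ?u "()"], of "{()}" x] False by simp
  then have "norm (cinner x ?u) \<le> norm x"
    by (simp add: power2_le_iff_abs_le)
  then show ?thesis
    using False by (simp add: cinner_scaleR_right divide_simps split: if_splits)
qed simp

lemma bounded_linear_cinner_left: "bounded_linear (\<lambda>x. cinner x (y::'a::complex_inner))"
  by (rule bounded_linear_intro[where K = "norm y"])
    (simp_all add: cinner_add_left cinner_scaleR_left cauchy_schwarz)

lemma bounded_linear_cinner_right: "bounded_linear (\<lambda>y. cinner (x::'a::complex_inner) y)"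
  by (rule bounded_linear_intro[where K = "norm x"])
    (simp_all add: cinner_add_right cinner_scaleR_right cauchy_schwarz mult.commute[of _ "norm x"])

section \<open>Bounded complex-linear operators\<close>

lemma bounded_clinear_add: "bounded_clinear T \<Longrightarrow> T (x + y) = T x + T y"
  by (simp add: bounded_clinear_def bounded_linear.axioms(1) linear_add bounded_linear.linear)

lemma bounded_clinear_diff: "bounded_clinear T \<Longrightarrow> T (x - y) = T x - T y"
  by (simp add: bounded_clinear_def linear_diff bounded_linear.linear)

lemma bounded_clinear_zero: "bounded_clinear T \<Longrightarrow> T 0 = 0"
  by (simp add: bounded_clinear_def linear_0 bounded_linear.linear)

lemma bounded_clinear_scaleC: "bounded_clinear T \<Longrightarrow> T (c *\<^sub>C x) = c *\<^sub>C T x"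
  by (simp add: bounded_clinear_def)

lemma bounded_clinear_ident: "bounded_clinear (\<lambda>x. x)"
  by (simp add: bounded_clinear_def)

lemma bounded_clinear_scaleC_op: "bounded_clinear ((*\<^sub>C) c :: 'a::complex_inner \<Rightarrow> 'a)"
proof -
  have "bounded_linear ((*\<^sub>C) c :: 'a \<Rightarrow> 'a)"
    by (rule bounded_linear_intro[where K = "norm c"])
      (simp_all add: scaleC_add_right norm_scaleC scaleR_scaleC scaleC_scaleC mult.commute)
  then show ?thesis
    by (simp add: bounded_clinear_def scaleC_scaleC mult.commute)
qed

lemma bounded_clinear_compose:
  "bounded_clinear S \<Longrightarrow> bounded_clinear T \<Longrightarrow> bounded_clinear (\<lambda>x. S (T x))"
  by (auto simp: bounded_clinear_def intro: bounded_linear_compose)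

lemma bounded_clinear_sub:
  "bounded_clinear S \<Longrightarrow> bounded_clinear T \<Longrightarrow> bounded_clinear (\<lambda>x. S x - T x)"
  by (auto simp: bounded_clinear_def complex_vector.scale_right_diff_distrib intro: bounded_linear_sub)

text \<open>The set where two bounded operators agree is a closed subspace, so it is everything as soon as
  it contains a basis.\<close>

lemma bounded_clinear_eqI:
  assumes h: "orthonormal_basis h" and S: "bounded_clinear S" and T: "bounded_clinear T"
    and eq: "\<And>n. S (h n) = T (h n)"
  shows "S x = T x"
proof -
  let ?E = "{x. S x = T x}"
  have "csubspace ?E"
    by (auto simp: complex_vector.subspace_def bounded_clinear_add[OF S] bounded_clinear_add[OF T]
      bounded_clinear_zero[OF S] bounded_clinear_zero[OF T]
      bounded_clinear_scaleC[OF S] bounded_clinear_scaleC[OF T])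
  then have "cspan (range h) \<subseteq> ?E"
    using eq by (intro complex_vector.span_minimal) auto
  moreover have "closed ?E"
    using S T by (intro closed_Collect_eq) (auto simp: bounded_clinear_def linear_continuous_on)
  ultimately have "closure (cspan (range h)) \<subseteq> ?E"
    by (rule closure_minimal)
  then show ?thesis
    using h by (auto simp: orthonormal_basis_def)
qed

section \<open>Diagonal operators\<close>

definition diagonal_op :: "(nat \<Rightarrow> 'a::chilbert_space) \<Rightarrow> (nat \<Rightarrow> complex) \<Rightarrow> 'a \<Rightarrow> 'a"
  where "diagonal_op f l x = (\<Sum>n. (l n * cinner x (f n)) *\<^sub>C f n)"

text \<open>By Pythagoras the squared norm of a block of the series is the corresponding block of the
  coefficient series, so the partial sums are Cauchy and completeness applies.\<close>

lemma summable_orthonormal_series: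
  fixes f :: "nat \<Rightarrow> 'a::chilbert_space"
  assumes f: "orthonormal_family UNIV f" and c: "summable (\<lambda>n. (norm (c n))\<^sup>2)"
  shows "summable (\<lambda>n. c n *\<^sub>C f n)"
proof -
  let ?S = "\<lambda>n. \<Sum>i<n. c i *\<^sub>C f i"
  have "Cauchy ?S"
  proof (rule CauchyI')
    fix e :: real assume e: "0 < e"
    then obtain N where N: "\<And>m n. m \<ge> N \<Longrightarrow> norm (\<Sum>i=m..<n. (norm (c i))\<^sup>2) < e\<^sup>2"
      using c unfolding summable_Cauchy by (meson zero_less_power)
    show "\<exists>M. \<forall>m\<ge>M. \<forall>n>m. dist (?S m) (?S n) < e"
    proof (intro exI[of _ N] allI impI)
      fix m n assume mn: "N \<le> m" "m < n"
      have "?S n - ?S m = (\<Sum>i=m..<n. c i *\<^sub>C f i)"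
        using mn sum_diff_nat_ivl[of 0 m n "\<lambda>i. c i *\<^sub>C f i"] by (simp add: atLeast0LessThan)
      then have "dist (?S m) (?S n) = norm (\<Sum>i=m..<n. c i *\<^sub>C f i)"
        by (subst dist_commute) (simp only: dist_norm)
      then have "(dist (?S m) (?S n))\<^sup>2 = (\<Sum>i=m..<n. (norm (c i))\<^sup>2)"
        using norm_orthonormal_sum[OF f, of "{m..<n}" c] by simp
      also have "\<dots> < e\<^sup>2"
        using N[OF mn(1), of n] by (simp add: sum_nonneg)
      finally show "dist (?S m) (?S n) < e"
        using e by (simp add: power_less_imp_less_base)
    qed
  qed
  then show ?thesis
    by (simp add: Cauchy_convergent summable_iff_convergent)
qed

text \<open>Bessel's inequality, weighted by \<open>l\<close>; it yields both the convergence of the series defining the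
  diagonal operator and the bound \<open>M\<close> for its norm.\<close>

lemma sum_diagonal_coeff_le:
  fixes f :: "nat \<Rightarrow> 'a::complex_inner"
  assumes f: "orthonormal_family UNIV f" and l: "\<forall>n. norm (l n) \<le> M"
  shows "(\<Sum>i<n. (norm (l i * cinner x (f i)))\<^sup>2) \<le> (M * norm x)\<^sup>2"
proof -
  have "(\<Sum>i<n. (norm (l i * cinner x (f i)))\<^sup>2) \<le> (\<Sum>i<n. M\<^sup>2 * (norm (cinner x (f i)))\<^sup>2)"
    by (intro sum_mono) (simp add: norm_mult power_mult_distrib l mult_right_mono power_mono)
  also have "\<dots> = M\<^sup>2 * (\<Sum>i<n. (norm (cinner x (f i)))\<^sup>2)"
    by (simp add: sum_distrib_left)
  also have "\<dots> \<le> M\<^sup>2 * (norm x)\<^sup>2"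
    by (intro mult_left_mono bessel_inequality[OF f]) auto
  finally show ?thesis
    by (simp add: power_mult_distrib)
qed

lemma diagonal_op_sums:
  assumes f: "orthonormal_family UNIV f" and l: "\<forall>n. norm (l n) \<le> M"
  shows "(\<lambda>n. (l n * cinner x (f n)) *\<^sub>C f n) sums diagonal_op f l x"
proof -
  have "summable (\<lambda>n. (norm (l n * cinner x (f n)))\<^sup>2)"
    by (rule summableI_nonneg_bounded[OF _ sum_diagonal_coeff_le[OF f l]]) simp
  then show ?thesis
    unfolding diagonal_op_def by (intro summable_sums summable_orthonormal_series[OF f])
qed

lemma bounded_clinear_diagonal_op:
  assumes f: "orthonormal_family UNIV f" and l: "\<forall>n. norm (l n) \<le> M"
  shows "bounded_clinear (diagonal_op f l)"
proof -
  note sums = diagonal_op_sums[OF f l]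
  have M: "0 \<le> M"
    using spec[OF l, of 0] norm_ge_zero[of "l 0"] by linarith
  have add: "diagonal_op f l (x + y) = diagonal_op f l x + diagonal_op f l y" for x y
    using sums_unique2[OF sums[of "x + y"]] sums_add[OF sums[of x] sums[of y]]
    by (simp add: cinner_add_left scaleC_add_left distrib_left)
  have scale: "diagonal_op f l (c *\<^sub>C x) = c *\<^sub>C diagonal_op f l x" for c x
  proof -
    have "(\<lambda>n. c *\<^sub>C ((l n * cinner x (f n)) *\<^sub>C f n)) sums (c *\<^sub>C diagonal_op f l x)"
      using bounded_clinear_scaleC_op[of c] unfolding bounded_clinear_def
      by (intro bounded_linear.sums[OF _ sums]) auto
    then show ?thesis
      using sums_unique2[OF sums[of "c *\<^sub>C x"]]
      by (simp add: cinner_scaleC_left scaleC_scaleC mult.left_commute)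
  qed
  have "norm (diagonal_op f l x) \<le> norm x * M" for x
  proof (rule LIMSEQ_le_const2)
    show "(\<lambda>n. norm (\<Sum>i<n. (l i * cinner x (f i)) *\<^sub>C f i)) \<longlonglongrightarrow> norm (diagonal_op f l x)"
      using sums[of x] by (intro tendsto_norm) (simp add: sums_def)
    have "(norm (\<Sum>i<n. (l i * cinner x (f i)) *\<^sub>C f i))\<^sup>2 \<le> (M * norm x)\<^sup>2" for n
      using sum_diagonal_coeff_le[OF f l] by (subst norm_orthonormal_sum[OF f]) auto
    then have "norm (\<Sum>i<n. (l i * cinner x (f i)) *\<^sub>C f i) \<le> M * norm x" for n
      by (rule power2_le_imp_le) (simp add: M)
    then show "\<exists>N. \<forall>n\<ge>N. norm (\<Sum>i<n. (l i * cinner x (f i)) *\<^sub>C f i) \<le> norm x * M"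
      by (auto simp: mult.commute)
  qed
  then have "bounded_linear (diagonal_op f l)"
    by (intro bounded_linear_intro[where K = M]) (auto simp: add scale scaleR_scaleC)
  then show ?thesis
    by (simp add: bounded_clinear_def scale)
qed

lemma diagonal_op_single:
  assumes "\<And>m. m \<noteq> n \<Longrightarrow> cinner x (f m) = 0"
  shows "diagonal_op f l x = (l n * cinner x (f n)) *\<^sub>C f n"
proof -
  have "diagonal_op f l x = (\<Sum>m\<in>{n}. (l m * cinner x (f m)) *\<^sub>C f m)"
    unfolding diagonal_op_def using assms by (intro suminf_finite) auto
  then show ?thesis
    by simp
qed

lemma diagonal_op_basis:
  "orthonormal_family UNIV f \<Longrightarrow> diagonal_op f l (f n) = l n *\<^sub>C f n"
  by (subst diagonal_op_single[where n = n]) (auto simp: orthonormal_familyD)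

lemma cinner_diagonal_op_left:
  assumes f: "orthonormal_family UNIV f" and l: "\<forall>n. norm (l n) \<le> M"
  shows "(\<lambda>n. l n * cinner x (f n) * cinner (f n) y) sums cinner (diagonal_op f l x) y"
  using bounded_linear.sums[OF bounded_linear_cinner_left diagonal_op_sums[OF f l], of x y]
  by (simp add: cinner_scaleC_left)

lemma cinner_diagonal_op_basis:
  assumes f: "orthonormal_family UNIV f" and l: "\<forall>n. norm (l n) \<le> M"
  shows "cinner (diagonal_op f l x) (f n) = l n * cinner x (f n)"
proof -
  have "(\<lambda>m. l m * cinner x (f m) * cinner (f m) (f n)) = (\<lambda>m. if m = n then l m * cinner x (f m) else 0)"
    using f by (auto simp: orthonormal_familyD)
  then have "(\<lambda>m. if m = n then l m * cinner x (f m) else 0) sums cinner (diagonal_op f l x) (f n)"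
    using cinner_diagonal_op_left[OF f l, of x "f n"] by simp
  then show ?thesis
    by (rule sums_unique2) (rule sums_single)
qed

abbreviation projection_op :: "(nat \<Rightarrow> 'a::chilbert_space) \<Rightarrow> 'a \<Rightarrow> 'a"
  where "projection_op f \<equiv> diagonal_op f (\<lambda>_. 1)"

text \<open>The range is described as the double orthogonal complement of the \<open>f n\<close>: that it is a closed
  subspace, that it contains the values of the series, and that the vectors \<open>x - P x\<close> (orthogonal to
  all \<open>f n\<close>) are orthogonal to it can all be read off.\<close>

lemma orthogonal_projection_op:
  assumes f: "orthonormal_family UNIV f"
  shows "orthogonal_projection (projection_op f)"
proof -
  let ?M = "{y. \<forall>x. (\<forall>n. cinner x (f n) = 0) \<longrightarrow> cinner x y = 0}"
  have "csubspace ?M"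
    by (simp add: complex_vector.subspace_def cinner_add_right cinner_scaleC_right)
  moreover have "closed ?M"
  proof -
    have "?M = (\<Inter>x\<in>{x. \<forall>n. cinner x (f n) = 0}. {y. cinner x y = 0})"
      by auto
    then show ?thesis
      by (simp only:) (intro closed_INT ballI closed_Collect_eq linear_continuous_on
        bounded_linear_cinner_right continuous_on_const)
  qed
  moreover have "cinner (x - projection_op f x) (f n) = 0" for x n
    by (simp add: cinner_diff_left cinner_diagonal_op_basis[OF f, where M = 1])
  moreover have "projection_op f x \<in> ?M" for x
  proof (intro CollectI allI impI)
    fix y assume y: "\<forall>n. cinner y (f n) = 0"
    have "cinner (f n) y = 0" for n
      using y cinner_commute[of "f n" y] by simp
    then have "cinner (projection_op f x) y = 0"
      using cinner_diagonal_op_left[OF f, of "\<lambda>_. 1" 1 x y] by (simp add: sums_iff)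
    then show "cinner y (projection_op f x) = 0"
      using cinner_commute[of y] by simp
  qed
  ultimately show ?thesis
    unfolding orthogonal_projection_def orthogonal_projection_onto_def by blast
qed

section \<open>Existence of an orthonormal basis\<close>

lemma orthonormal_family_reindex:
  assumes "orthonormal_family I f" "g ` J \<subseteq> I" "inj_on g J"
  shows "orthonormal_family J (\<lambda>j. f (g j))"
  using assms by (auto simp: orthonormal_family_def inj_on_def image_subset_iff)

lemma dist_orthonormal_gt_1:
  assumes f: "orthonormal_family I f" and "i \<in> I" "j \<in> I" "i \<noteq> j"
  shows "1 < dist (f i) (f j)"
proof -
  have "complex_of_real ((dist (f i) (f j))\<^sup>2) = cinner (f i - f j) (f i - f j)"
    by (simp only: cinner_self dist_norm)
  also have "\<dots> = complex_of_real 2"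
    using assms by (simp add: cinner_diff_left cinner_diff_right orthonormal_familyD)
  finally have "(dist (f i) (f j))\<^sup>2 = 2"
    by (simp only: of_real_eq_iff)
  then show ?thesis
    by (intro power_less_imp_less_base[where a = 1 and n = 2]) simp_all
qed

text \<open>Vectors of the family are more than \<open>1\<close> apart, so the balls of radius \<open>1/2\<close> around them
  contain different members of a countable dense set.\<close>

lemma countable_orthonormal:
  fixes f :: "'i \<Rightarrow> 'a::complex_inner"
  assumes sep: "separable_space (euclidean :: 'a topology)" and f: "orthonormal_family I f"
  shows "countable I"
proof -
  obtain U :: "'a set" where U: "countable U" "closure U = UNIV"
    using sep by (auto simp: separable_space_def)
  have "\<exists>u\<in>U. dist u (f i) < 1/2" for i
    using U(2) by (metis UNIV_I closure_approachable half_gt_zero zero_less_one)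
  then obtain g where g: "\<And>i. g i \<in> U" "\<And>i. dist (g i) (f i) < 1/2"
    by metis
  have "inj_on g I"
  proof (rule inj_onI, rule ccontr)
    fix i j assume "i \<in> I" "j \<in> I" "g i = g j" "i \<noteq> j"
    then show False
      using dist_orthonormal_gt_1[OF f, of i j] g(2)[of i] g(2)[of j]
        dist_triangle2[of "f i" "f j" "g i"] by (simp add: dist_commute)
  qed
  then show ?thesis
    using U(1) g(1) by (meson countable_image_inj_on countable_subset image_subsetI)
qed

text \<open>Zorn's lemma: a nonzero vector orthogonal to a maximal orthonormal set could be normalized and
  added to it.\<close>

lemma maximal_orthonormal_set:
  obtains B :: "'a::complex_inner set"
  where "orthonormal_family B id" "\<And>x. (\<And>b. b \<in> B \<Longrightarrow> cinner x b = 0) \<Longrightarrow> x = 0"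
proof -
  let ?A = "{B :: 'a set. orthonormal_family B id}"
  have "\<exists>B\<in>?A. \<forall>X\<in>?A. B \<subseteq> X \<longrightarrow> X = B"
  proof (rule subset_Zorn')
    fix C assume C: "subset.chain ?A C"
    have "cinner x y = (if x = y then 1 else 0)"
      if "X \<in> C" "Y \<in> C" "x \<in> X" "y \<in> Y" for X Y x y
    proof -
      have "X \<subseteq> Y \<or> Y \<subseteq> X"
        using C that by (auto simp: subset_chain_def)
      moreover have "orthonormal_family X id" "orthonormal_family Y id"
        using C that by (auto simp: subset_chain_def)
      ultimately show ?thesis
        using that orthonormal_familyD[of X id x y] orthonormal_familyD[of Y id x y] by auto
    qed
    then show "\<Union>C \<in> ?A"
      by (auto simp: orthonormal_family_def)
  qed
  then obtain B :: "'a set" where B: "orthonormal_family B id"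
    and max: "\<And>X. orthonormal_family X id \<Longrightarrow> B \<subseteq> X \<Longrightarrow> X = B"
    by blast
  have "x = 0" if x: "\<And>b. b \<in> B \<Longrightarrow> cinner x b = 0" for x
  proof (rule ccontr)
    assume "x \<noteq> 0"
    define u where "u = (1 / norm x) *\<^sub>R x"
    have ub: "cinner u b = 0" "cinner b u = 0" if "b \<in> B" for b
      using x[OF that] cinner_commute[of b u] by (simp_all add: u_def cinner_scaleR_left)
    have uu: "cinner u u = 1"
      using \<open>x \<noteq> 0\<close> by (simp add: cinner_self u_def)
    have "orthonormal_family (insert u B) id"
      using B ub uu by (auto simp: orthonormal_family_def)
    then have "u \<in> B"
      using max by blast
    then show False
      using ub(1) uu by force
  qed
  then show thesis
    using that B by blast
qed

text \<open>A maximal orthonormal set is countable by separability. Subtracting from a vector its Fourier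
  series leaves something orthogonal to the set, hence \<open>0\<close>. So the set has dense span; were it
  finite, it would even span the space.\<close>

lemma exists_orthonormal_basis:
  assumes sep: "separable_space (euclidean :: 'a::chilbert_space topology)"
    and inf: "infinite_dimensional TYPE('a::chilbert_space)"
  obtains h :: "nat \<Rightarrow> 'a::chilbert_space" where "orthonormal_basis h"
proof -
  obtain B :: "'a set" where B: "orthonormal_family B id"
    and max: "\<And>x. (\<And>b. b \<in> B \<Longrightarrow> cinner x b = 0) \<Longrightarrow> x = 0"
    using maximal_orthonormal_set by blast
  have "infinite B"
  proof
    assume fin: "finite B"
    have "x \<in> cspan B" for x
    proof -
      have "x - (\<Sum>b\<in>B. cinner x b *\<^sub>C b) = 0"
        by (rule max)
          (use cinner_orthonormal_sum[OF B fin] in \<open>simp add: cinner_diff_left\<close>)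
      then have "x = (\<Sum>b\<in>B. cinner x b *\<^sub>C b)"
        by simp
      also have "\<dots> \<in> cspan B"
        by (intro complex_vector.span_sum complex_vector.span_scale complex_vector.span_base)
      finally show ?thesis .
    qed
    then show False
      using inf fin unfolding infinite_dimensional_def by blast
  qed
  define h where "h = from_nat_into B"
  have range: "range h = B" and "inj h"
    using bij_betw_from_nat_into[OF countable_orthonormal[OF sep B] \<open>infinite B\<close>]
    by (auto simp: h_def bij_betw_def)
  then have h: "orthonormal_family UNIV h"
    using orthonormal_family_reindex[OF B, of h UNIV] by simp
  have "x \<in> closure (cspan (range h))" for x
  proof -
    have "x - projection_op h x = 0"
    proof (rule max)
      fix b assume "b \<in> B"
      then obtain n where "b = h n"
        using range by blast
      then show "cinner (x - projection_op h x) b = 0"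
        by (simp add: cinner_diff_left cinner_diagonal_op_basis[OF h, where M = 1])
    qed
    then have "(\<lambda>n. \<Sum>i<n. cinner x (h i) *\<^sub>C h i) \<longlonglongrightarrow> x"
      using diagonal_op_sums[OF h, of "\<lambda>_. 1" 1 x] by (simp add: sums_def)
    moreover have "(\<Sum>i<n. cinner x (h i) *\<^sub>C h i) \<in> cspan (range h)" for n
      by (intro complex_vector.span_sum complex_vector.span_scale complex_vector.span_base) auto
    ultimately show ?thesis
      unfolding closure_sequential by (intro exI conjI allI)
  qed
  then show thesis
    using that[of h] h by (auto simp: orthonormal_basis_def orthonormal_family_def)
qed

section \<open>Spectra\<close>

text \<open>A bounded inverse \<open>S\<close> of \<open>T - z\<close> would keep \<open>T x - z x\<close> at least \<open>1 / \<parallel>S\<parallel>\<close> away from \<open>0\<close> for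
  unit vectors \<open>x\<close>.\<close>

lemma approximate_eigenvalue_in_spectrum:
  assumes "\<And>e. e > 0 \<Longrightarrow> \<exists>x. norm x = 1 \<and> norm (T x - z *\<^sub>C x) < e"
  shows "z \<in> op_spectrum T"
proof (rule ccontr)
  assume "z \<notin> op_spectrum T"
  then obtain S where S: "bounded_clinear S" and inv: "\<And>x. S (T x - z *\<^sub>C x) = x"
    unfolding op_spectrum_def by blast
  obtain C where C: "C > 0" "\<And>x. norm (S x) \<le> norm x * C"
    using S bounded_linear.pos_bounded unfolding bounded_clinear_def by blast
  obtain x where x: "norm x = 1" "norm (T x - z *\<^sub>C x) < 1 / C"
    using assms[of "1 / C"] C(1) by auto
  have "1 \<le> norm (T x - z *\<^sub>C x) * C"
    using C(2)[of "T x - z *\<^sub>C x"] inv x(1) by simp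
  also have "\<dots> < 1"
    using x(2) C(1) by (simp add: field_simps)
  finally show False by simp
qed

text \<open>If \<open>R\<close> inverts \<open>AB - z\<close>, then \<open>(B R A - 1) / z\<close> inverts \<open>BA - z\<close>. The formula is suggested by the
  geometric series: \<open>R\<close> is \<open>- \<Sum>\<^sub>k (AB)\<^sup>k / z\<^bsup>k+1\<^esup>\<close> for large \<open>z\<close>, and \<open>B (AB)\<^sup>k A = (BA)\<^bsup>k+1\<^esup>\<close>.\<close>

lemma nonzero_spectrum_commute:
  assumes A: "bounded_clinear A" and B: "bounded_clinear B"
  shows "op_spectrum (B \<circ> A) - {0} \<subseteq> op_spectrum (A \<circ> B)"
proof
  fix z assume z: "z \<in> op_spectrum (B \<circ> A) - {0}"
  show "z \<in> op_spectrum (A \<circ> B)"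
  proof (rule ccontr)
    assume "z \<notin> op_spectrum (A \<circ> B)"
    then obtain R where R: "bounded_clinear R"
      and R1: "\<And>x. R (A (B x) - z *\<^sub>C x) = x" and R2: "\<And>x. A (B (R x)) - z *\<^sub>C R x = x"
      unfolding op_spectrum_def by auto
    define S where "S = (\<lambda>x. inverse z *\<^sub>C (B (R (A x)) - x))"
    note lin = bounded_clinear_diff[OF A] bounded_clinear_diff[OF B] bounded_clinear_diff[OF R]
      bounded_clinear_scaleC[OF A] bounded_clinear_scaleC[OF B] bounded_clinear_scaleC[OF R]
    have "bounded_clinear S"
      unfolding S_def
      by (intro bounded_clinear_compose[OF bounded_clinear_scaleC_op] bounded_clinear_sub
        bounded_clinear_compose[OF B] bounded_clinear_compose[OF R] A bounded_clinear_ident)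
    moreover have "S (B (A x) - z *\<^sub>C x) = x" for x
    proof -
      have "B (R (A (B (A x) - z *\<^sub>C x))) = B (A x)"
        using R1[of "A x"] by (simp add: lin)
      then show ?thesis
        using z by (simp add: S_def scaleC_scaleC scaleC_one)
    qed
    moreover have "B (A (S x)) - z *\<^sub>C S x = x" for x
    proof -
      have "A (B (R (A x))) = A x + z *\<^sub>C R (A x)"
        using R2[of "A x"] by (simp add: algebra_simps)
      then have "B (A (S x)) = B (R (A x))"
        using z by (simp add: S_def lin scaleC_scaleC scaleC_one)
      then show ?thesis
        using z by (simp add: S_def scaleC_scaleC scaleC_one)
    qed
    ultimately show False
      using z unfolding op_spectrum_def by auto
  qed
qed

text \<open>Away from the closure of the diagonal entries, the reciprocals \<open>1 / (l n - z)\<close> are bounded and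
  define a diagonal inverse.\<close>

lemma spectrum_diagonal_op_subset:
  assumes h: "orthonormal_basis h" and l: "\<forall>n. norm (l n) \<le> M"
  shows "op_spectrum (diagonal_op h l) \<subseteq> closure (range l)"
proof
  fix z assume z: "z \<in> op_spectrum (diagonal_op h l)"
  show "z \<in> closure (range l)"
  proof (rule ccontr)
    assume "z \<notin> closure (range l)"
    then obtain d where d: "d > 0" "\<And>n. norm (l n - z) \<ge> d"
      unfolding closure_approachable dist_norm by (metis linorder_not_le rangeI)
    have f: "orthonormal_family UNIV h"
      using h by (simp add: orthonormal_basis_def orthonormal_family_def)
    define r where "r n = inverse (l n - z)" for n
    have nz: "l n - z \<noteq> 0" for n
      using d(1) d(2)[of n] by auto
    have r: "\<forall>n. norm (r n) \<le> inverse d"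
      using d by (simp add: r_def norm_inverse le_imp_inverse_le)
    note D = bounded_clinear_diagonal_op[OF f l] and R = bounded_clinear_diagonal_op[OF f r]
    have cancel: "(l n - z) * r n = 1" for n
      using nz by (simp add: r_def)
    have 1: "diagonal_op h r (diagonal_op h l x - z *\<^sub>C x) = x" for x
    proof (rule bounded_clinear_eqI[OF h _ bounded_clinear_ident])
      show "bounded_clinear (\<lambda>x. diagonal_op h r (diagonal_op h l x - z *\<^sub>C x))"
        by (intro bounded_clinear_compose[OF R] bounded_clinear_sub D bounded_clinear_scaleC_op)
      show "diagonal_op h r (diagonal_op h l (h n) - z *\<^sub>C h n) = h n" for n
        by (simp only: diagonal_op_basis[OF f] bounded_clinear_scaleC[OF R] scaleC_scaleC
            complex_vector.scale_left_diff_distrib[symmetric] cancel scaleC_one)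
    qed
    have 2: "diagonal_op h l (diagonal_op h r x) - z *\<^sub>C diagonal_op h r x = x" for x
    proof (rule bounded_clinear_eqI[OF h _ bounded_clinear_ident])
      show "bounded_clinear (\<lambda>x. diagonal_op h l (diagonal_op h r x) - z *\<^sub>C diagonal_op h r x)"
        by (intro bounded_clinear_compose[OF D] bounded_clinear_sub R
            bounded_clinear_compose[OF bounded_clinear_scaleC_op])
      show "diagonal_op h l (diagonal_op h r (h n)) - z *\<^sub>C diagonal_op h r (h n) = h n" for n
        by (simp only: diagonal_op_basis[OF f] bounded_clinear_scaleC[OF D] scaleC_scaleC
            complex_vector.scale_left_diff_distrib[symmetric] mult.commute[of "r n"]
            left_diff_distrib[symmetric] cancel scaleC_one)
    qed
    show False
      using z 1 2 R unfolding op_spectrum_def by blast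
  qed
qed

section \<open>Two projections with prescribed spectrum\<close>

theorem theorem3p29:
  fixes K :: "real set"
  assumes separable: "separable_space (euclidean :: 'a::chilbert_space topology)"
    and infinite_dim: "infinite_dimensional TYPE('a)"
    and K: "compact K" "K \<subseteq> {0..1}" "0 \<in> K"
  shows "\<exists>P1 P2 :: 'a \<Rightarrow> 'a. orthogonal_projection P1 \<and> orthogonal_projection P2 \<and>
    op_spectrum (P2 \<circ> P1) = complex_of_real ` K \<and> diagonalizable (P1 \<circ> P2 \<circ> P1)"
proof -
  obtain h :: "nat \<Rightarrow> 'a" where h: "orthonormal_basis h"
    using exists_orthonormal_basis[OF separable infinite_dim] .
  then have f: "orthonormal_family UNIV h"
    by (simp add: orthonormal_basis_def orthonormal_family_def)
  have hh: "cinner (h m) (h n) = (if m = n then 1 else 0)" for m n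
    using f by (simp add: orthonormal_family_def)
  obtain L where L: "countable L" "L \<subseteq> K" "K \<subseteq> closure L"
    using Topology_Euclidean_Space.separable .
  define t where "t = from_nat_into L"
  have "L \<noteq> {}"
    using L(3) K(3) by auto
  then have range_t: "range t = L"
    unfolding t_def using L(1) by (rule range_from_nat_into)
  then have tK: "t n \<in> K" for n
    using L(2) by blast
  then have t: "0 \<le> t n" "t n \<le> 1" for n
    using K(2) by (force simp: subset_iff)+
  define u where "u n = h (2 * n)" for n
  define w where "w n = h (2 * n + 1)" for n
  define v where "v n = complex_of_real (sqrt (t n)) *\<^sub>C u n + complex_of_real (sqrt (1 - t n)) *\<^sub>C w n" for n
  have inner: "cinner (u m) (u n) = (if m = n then 1 else 0)" "cinner (w m) (w n) = (if m = n then 1 else 0)"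
    "cinner (u m) (w n) = 0" "cinner (w m) (u n) = 0" for m n
    by (auto simp: u_def w_def hh double_not_eq_Suc_double Suc_double_not_eq_double)
  have ou: "orthonormal_family UNIV u"
    by (simp add: orthonormal_family_def inner)
  have sq: "complex_of_real (sqrt a) * complex_of_real (sqrt a) = complex_of_real a" if "0 \<le> a" for a
    using that by (simp flip: of_real_mult)
  have ov: "orthonormal_family UNIV v"
    using t by (simp add: orthonormal_family_def v_def cinner_add_left cinner_add_right
        cinner_scaleC_left cinner_scaleC_right inner sq)
  define P1 where "P1 = projection_op u"
  define P2 where "P2 = projection_op v"
  have b1: "bounded_clinear P1" and b2: "bounded_clinear P2"
    unfolding P1_def P2_def
    by (rule bounded_clinear_diagonal_op[where M = 1], auto intro: ou ov)+
  have P1u: "P1 (u n) = u n" and P2v: "P2 (v n) = v n" for n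
    unfolding P1_def P2_def by (simp_all add: diagonal_op_basis ou ov scaleC_one)
  have P1w: "P1 (w n) = 0" for n
    unfolding P1_def by (subst diagonal_op_single[where n = n]) (auto simp: inner)
  have P1v: "P1 (v n) = complex_of_real (sqrt (t n)) *\<^sub>C u n" for n
    by (simp add: v_def bounded_clinear_add[OF b1] bounded_clinear_scaleC[OF b1] P1u P1w)
  have P2u: "P2 (u n) = complex_of_real (sqrt (t n)) *\<^sub>C v n" for n
    unfolding P2_def by (subst diagonal_op_single[where n = n])
      (auto simp: v_def cinner_add_right cinner_scaleC_right inner)
  define l where "l n = complex_of_real (if even n then t (n div 2) else 0)" for n
  have l: "\<forall>n. norm (l n) \<le> 1"
    using t by (simp add: l_def)
  have D: "P1 (P2 (P1 x)) = diagonal_op h l x" for x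
  proof (rule bounded_clinear_eqI[OF h, where S = "\<lambda>x. P1 (P2 (P1 x))"])
    fix n
    show "P1 (P2 (P1 (h n))) = diagonal_op h l (h n)"
    proof (cases "even n")
      case True
      then obtain m where m: "n = 2 * m"
        by blast
      have "P1 (P2 (P1 (u m))) = complex_of_real (t m) *\<^sub>C u m"
        using t(1) by (simp add: P1u P2u P1v bounded_clinear_scaleC[OF b1] scaleC_scaleC sq)
      then show ?thesis
        unfolding diagonal_op_basis[OF f] by (simp add: m l_def u_def)
    next
      case False
      then obtain m where m: "n = 2 * m + 1"
        using oddE by blast
      have "P1 (P2 (P1 (w m))) = 0"
        by (simp add: P1w bounded_clinear_zero b1 b2)
      then show ?thesis
        unfolding diagonal_op_basis[OF f] by (simp add: m l_def w_def)
    qed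
  qed (intro bounded_clinear_compose[OF b1] bounded_clinear_compose[OF b2] b1
      bounded_clinear_diagonal_op[OF f l])+
  have "diagonalizable (P1 \<circ> P2 \<circ> P1)"
    unfolding diagonalizable_def comp_def D using h diagonal_op_sums[OF f l] by blast
  moreover have "op_spectrum (P2 \<circ> P1) \<subseteq> complex_of_real ` K"
  proof
    fix z assume z: "z \<in> op_spectrum (P2 \<circ> P1)"
    show "z \<in> complex_of_real ` K"
    proof (cases "z = 0")
      case False
      have PP: "P1 (P1 x) = P1 x" for x
      proof (rule bounded_clinear_eqI[OF h, where S = "\<lambda>x. P1 (P1 x)"])
        fix n
        show "P1 (P1 (h n)) = P1 (h n)"
        proof (cases "even n")
          case True
          then show ?thesis using P1u[of "n div 2"] by (simp add: u_def)
        next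
          case False
          then show ?thesis using P1w[of "n div 2"] by (simp add: w_def bounded_clinear_zero[OF b1])
        qed
      qed (intro bounded_clinear_compose[OF b1] b1)+
      \<comment> \<open>Since \<open>P1\<close> is idempotent, \<open>P2 P1 = (P2 P1) P1\<close>, whose factors can be swapped into
        the diagonal operator \<open>P1 P2 P1\<close>.\<close>
      have "z \<in> op_spectrum ((P2 \<circ> P1) \<circ> P1) - {0}"
        using z False by (simp add: comp_def PP)
      moreover have "bounded_clinear (P2 \<circ> P1)"
        unfolding comp_def by (rule bounded_clinear_compose[OF b2 b1])
      ultimately have "z \<in> op_spectrum (P1 \<circ> (P2 \<circ> P1))"
        using nonzero_spectrum_commute[OF b1] by blast
      then have "z \<in> closure (range l)"
        using spectrum_diagonal_op_subset[OF h l] by (auto simp: comp_def D)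
      moreover have "range l \<subseteq> complex_of_real ` K"
        using tK K(3) by (auto simp: l_def)
      moreover have "closed (complex_of_real ` K)"
        using K(1) by (intro compact_imp_closed compact_continuous_image continuous_intros)
      ultimately show ?thesis
        using closure_minimal by blast
    qed (use K(3) in auto)
  qed
  moreover have "complex_of_real ` K \<subseteq> op_spectrum (P2 \<circ> P1)"
  proof
    fix z assume "z \<in> complex_of_real ` K"
    then obtain k where k: "z = complex_of_real k" "k \<in> closure (range t)"
      using L(3) range_t by auto
    show "z \<in> op_spectrum (P2 \<circ> P1)"
    proof (rule approximate_eigenvalue_in_spectrum)
      fix e :: real assume "e > 0"
      then obtain n where n: "\<bar>t n - k\<bar> < e"
        using k(2) by (auto simp: closure_approachable dist_real_def)
      have "(P2 \<circ> P1) (v n) - z *\<^sub>C v n = complex_of_real (t n - k) *\<^sub>C v n"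
        using t(1) by (simp add: P1v P2u bounded_clinear_scaleC[OF b2] scaleC_scaleC sq k(1)
            complex_vector.scale_left_diff_distrib)
      then show "\<exists>x. norm x = 1 \<and> norm ((P2 \<circ> P1) x - z *\<^sub>C x) < e"
        using n orthonormal_family_norm[OF ov, of n]
        by (intro exI[of _ "v n"]) (simp only: norm_scaleC norm_of_real, simp)
    qed
  qed
  ultimately show ?thesis
    using orthogonal_projection_op[OF ou] orthogonal_projection_op[OF ov]
    unfolding P1_def P2_def by blast
qed

end
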